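(* Let $G$ be an $n$-vertex graph with maximum degree $\Delta$ and arboricity $a$. There is a deterministic distributed algorithm in the LOCAL model that computes a proper edge coloring of $G$ with $\Delta+O(a)$ colors within $O(a\log n)$ rounds.
   Context: LOCAL model: the input graph is the communication network; each vertex is a processor with a unique ID of $O(\log n)$ bits and unbounded local computation; computation proceeds in synchronous rounds, in each of which every vertex may send a message of arbitrary size to each neighbor; running time is the number of rounds until all vertices terminate. Global parameters ($n$, $\Delta$, $a$) are known to all vertices. The arboricity of a graph is the minimum number of forests into which its edge set can be partitioned. In an edge coloring, edges sharing an endpoint receive distinct colors, and both endpoints of an edge know its color. *)

theory Defs
  imports Complex_Main
begin

text \<open>Simple undirected graphs: vertices are natural numbers, which double as the
unique processor IDs; edges are 2-element sets of vertices.\<close>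

definition simple_graph :: "nat set \<Rightarrow> nat set set \<Rightarrow> bool" where
  "simple_graph V E \<longleftrightarrow> finite V \<and>
     (\<forall>e\<in>E. \<exists>u v. u \<noteq> v \<and> u \<in> V \<and> v \<in> V \<and> e = {u, v})"

definition degree :: "nat set set \<Rightarrow> nat \<Rightarrow> nat" where
  "degree E v = card {e\<in>E. v \<in> e}"

definition max_degree :: "nat set \<Rightarrow> nat set set \<Rightarrow> nat" where
  "max_degree V E = (if V = {} then 0 else Max (degree E ` V))"

definition is_cycle :: "nat set set \<Rightarrow> nat list \<Rightarrow> bool" where
  "is_cycle F vs \<longleftrightarrow> length vs \<ge> 3 \<and> distinct vs \<and>
     (\<forall>i < length vs. {vs ! i, vs ! ((i + 1) mod length vs)} \<in> F)"

definition forest :: "nat set set \<Rightarrow> bool" where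
  "forest F \<longleftrightarrow> \<not> (\<exists>vs. is_cycle F vs)"

definition arboricity :: "nat set set \<Rightarrow> nat" where
  "arboricity E = (LEAST k. \<exists>f :: nat set \<Rightarrow> nat.
      (\<forall>e\<in>E. f e < k) \<and> (\<forall>i<k. forest {e\<in>E. f e = i}))"

text \<open>Synchronous execution of a deterministic LOCAL algorithm.
  init v N : initial state of the vertex with ID v and neighbour-ID set N;
  send s u : message sent by a vertex in state s to its neighbour with ID u
             (messages of unbounded size, encoded as natural numbers);
  step s M : new state, given the old state s and received messages M
             (M u = Some m if u is a neighbour and sent m, None otherwise).
States and messages are natural numbers (any finite information can be encoded).\<close>

definition nbrs :: "nat set set \<Rightarrow> nat \<Rightarrow> nat set" where
  "nbrs E v = {u. {u, v} \<in> E}"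

fun run :: "(nat \<Rightarrow> nat set \<Rightarrow> nat) \<Rightarrow> (nat \<Rightarrow> (nat \<Rightarrow> nat option) \<Rightarrow> nat)
            \<Rightarrow> (nat \<Rightarrow> nat \<Rightarrow> nat) \<Rightarrow> nat set set \<Rightarrow> nat \<Rightarrow> nat \<Rightarrow> nat" where
  "run init step send E 0 v = init v (nbrs E v)"
| "run init step send E (Suc t) v =
     step (run init step send E t v)
          (\<lambda>u. if {u, v} \<in> E then Some (send (run init step send E t u) v) else None)"

definition local_colour :: "(nat \<Rightarrow> nat set \<Rightarrow> nat) \<Rightarrow> (nat \<Rightarrow> (nat \<Rightarrow> nat option) \<Rightarrow> nat)
            \<Rightarrow> (nat \<Rightarrow> nat \<Rightarrow> nat) \<Rightarrow> (nat \<Rightarrow> nat \<Rightarrow> nat) \<Rightarrow> nat \<Rightarrow> nat set set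
            \<Rightarrow> nat \<Rightarrow> nat \<Rightarrow> nat" where
  "local_colour init step send out T E v u = out (run init step send E T v) u"

definition proper_edge_colouring_output :: "nat set set \<Rightarrow> (nat \<Rightarrow> nat \<Rightarrow> nat) \<Rightarrow> bool" where
  "proper_edge_colouring_output E c \<longleftrightarrow>
     (\<forall>u v. {u, v} \<in> E \<longrightarrow> c u v = c v u) \<and>
     (\<forall>v u w. {v, u} \<in> E \<and> {v, w} \<in> E \<and> u \<noteq> w \<longrightarrow> c v u \<noteq> c v w)"

definition colours_used :: "nat set set \<Rightarrow> (nat \<Rightarrow> nat \<Rightarrow> nat) \<Rightarrow> nat set" where
  "colours_used E c = {c v u | v u. {v, u} \<in> E}"

end

theory Submission
  imports Defs "HOL-Library.Nat_Bijection"
begin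

text \<open>Repeatedly peeling off the vertices of remaining degree at most \<open>A = 4a\<close> halves the graph each
  time, so it yields \<open>O(log n)\<close> layers in which every vertex has at most \<open>A\<close> neighbours in its own
  and higher layers. Orient an edge towards the higher layer, and inside a layer towards the endpoint
  whose ID has a 1 in the first bit where the two IDs differ. Colour first the edges inside layers,
  one bit position after the other, then the edges between layers from the top layer downwards; in
  each of these \<open>O(log n)\<close> stages the at most \<open>A\<close> out-edges of a vertex are treated one at a time.
  The edges treated simultaneously form disjoint stars around their heads, so two rounds suffice to
  colour them greedily, and at that moment an edge sees at most \<open>A\<close> coloured edges at its tail and
  at most \<open>\<Delta>\<close> at its head. Since messages are unbounded, a vertex can collect its whole view, and
  it suffices to show that the colours are determined by views of the right radius.\<close>

section \<open>Density of graphs of bounded arboricity\<close>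

lemma forest_subset: "forest F \<Longrightarrow> F' \<subseteq> F \<Longrightarrow> forest F'"
  unfolding forest_def is_cycle_def by blast

lemma simple_graph_finite: "simple_graph V E \<Longrightarrow> finite V"
  by (simp add: simple_graph_def)

lemma simple_graph_edgeE:
  assumes "simple_graph V E" "e \<in> E"
  obtains u v where "u \<noteq> v" "u \<in> V" "v \<in> V" "e = {u, v}"
  using assms unfolding simple_graph_def by metis

lemma simple_graph_nbrsD:
  assumes "simple_graph V E" "u \<in> nbrs E v"
  shows "u \<in> V" "v \<in> V" "u \<noteq> v"
proof -
  obtain x y where "x \<noteq> y" "x \<in> V" "y \<in> V" "{u, v} = {x, y}"
    using assms simple_graph_edgeE unfolding nbrs_def by (metis mem_Collect_eq)
  then show "u \<in> V" "v \<in> V" "u \<noteq> v" by (auto simp: doubleton_eq_iff)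
qed

lemma finite_nbrs: "simple_graph V E \<Longrightarrow> finite (nbrs E v)"
  by (meson finite_subset simple_graph_finite simple_graph_nbrsD(1) subsetI)

lemma simple_graph_subgraph:
  assumes "simple_graph V E" "F \<subseteq> E" "W \<subseteq> V" "\<And>e. e \<in> F \<Longrightarrow> e \<subseteq> W"
  shows "simple_graph W F"
  unfolding simple_graph_def
proof (intro conjI ballI)
  show "finite W" using assms(1,3) simple_graph_finite finite_subset by blast
  fix e assume e: "e \<in> F"
  then obtain u v where "u \<noteq> v" "e = {u, v}" using assms(1,2)
    by (meson simple_graph_edgeE subsetD)
  moreover from this have "u \<in> W" "v \<in> W" using assms(4)[OF e] by simp_all
  ultimately show "\<exists>u v. u \<noteq> v \<and> u \<in> W \<and> v \<in> W \<and> e = {u, v}"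
    by (intro exI[of _ u] exI[of _ v]) simp
qed

lemma simple_graph_finite_edges: "simple_graph V E \<Longrightarrow> finite E"
proof -
  assume sg: "simple_graph V E"
  have "e \<subseteq> V" if e: "e \<in> E" for e
  proof -
    obtain x y where "x \<in> V" "y \<in> V" "e = {x, y}"
      using simple_graph_edgeE[OF sg e] by metis
    then show ?thesis by simp
  qed
  then have "E \<subseteq> Pow V" by blast
  then show ?thesis using sg finite_subset simple_graph_finite by blast
qed

lemma incident_edges_eq:
  assumes "simple_graph V E"
  shows "{e \<in> E. v \<in> e} = (\<lambda>u. {u, v}) ` nbrs E v"
proof -
  have "e \<in> (\<lambda>u. {u, v}) ` nbrs E v" if e: "e \<in> E" "v \<in> e" for e
  proof -
    obtain x y where "e = {x, y}" using simple_graph_edgeE[OF assms e(1)] by metis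
    then have "e = {x, v} \<or> e = {y, v}" using e(2) by (auto simp: insert_commute)
    then show ?thesis using e(1) by (auto simp: nbrs_def)
  qed
  then show ?thesis by (auto simp: nbrs_def)
qed

lemma degree_eq_card_nbrs:
  assumes "simple_graph V E"
  shows "degree E v = card (nbrs E v)"
  unfolding degree_def incident_edges_eq[OF assms]
  by (rule card_image) (auto simp: inj_on_def doubleton_eq_iff)

text \<open>The endpoint of a longest path has all its neighbours on that path, so a second neighbour
  would close a cycle.\<close>
lemma forest_has_leaf:
  assumes sg: "simple_graph W F" and ne: "W \<noteq> {}" and "forest F"
  shows "\<exists>v\<in>W. card (nbrs F v) \<le> 1"
proof (rule ccontr)
  assume "\<not> ?thesis"
  then have deg: "card (nbrs F v) \<ge> 2" if "v \<in> W" for v using that by force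
  define path where "path vs \<longleftrightarrow> (\<forall>i. Suc i < length vs \<longrightarrow> {vs ! i, vs ! Suc i} \<in> F)" for vs
  define P where "P = {vs. set vs \<subseteq> W \<and> distinct vs \<and> path vs \<and> vs \<noteq> []}"
  have "finite W" using sg by (rule simple_graph_finite)
  then have "finite {vs. set vs \<subseteq> W \<and> distinct vs}" by (rule finite_subset_distinct)
  then have finP: "finite P" by (rule rev_finite_subset) (auto simp: P_def)
  obtain w where "w \<in> W" using ne by blast
  then have "[w] \<in> P" by (auto simp: P_def path_def)
  then have Pne: "P \<noteq> {}" by blast
  have "Max (length ` P) \<in> length ` P" using finP Pne by (intro Max_in) auto
  then obtain vs where vs: "vs \<in> P" "length vs = Max (length ` P)" by force
  then have longest: "length us \<le> length vs" if "us \<in> P" for us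
    using that finP by simp
  define x where "x = vs ! 0"
  have len: "length vs > 0" using vs(1) by (simp add: P_def)
  then have "x \<in> W" using vs(1) unfolding P_def x_def by (auto simp: subset_iff)
  \<comment> \<open>One of at least two neighbours of \<open>x\<close> differs from
    \<open>vs ! 1\<close>. If the path has a single vertex, \<open>vs ! 1\<close> is just an
    arbitrary value to avoid.\<close>
  then have "\<not> card (nbrs F x) \<le> card {vs ! 1}" using deg[of x] by simp
  then have "\<not> nbrs F x \<subseteq> {vs ! 1}" using card_mono[of "{vs ! 1}"] by blast
  then obtain y where y: "y \<in> nbrs F x" "y \<noteq> vs ! 1" by blast
  have yW: "y \<in> W" and yx: "y \<noteq> x" using simple_graph_nbrsD[OF sg y(1)] by auto
  have "y \<in> set vs"
  proof (rule ccontr)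
    assume "y \<notin> set vs"
    moreover have "path (y # vs)"
      using vs(1) y(1) unfolding P_def path_def x_def nbrs_def
      by (auto simp: nth_Cons split: nat.split)
    ultimately have "y # vs \<in> P" using vs(1) yW by (simp add: P_def)
    then show False using longest by fastforce
  qed
  then obtain j where j: "j < length vs" "vs ! j = y" by (auto simp: in_set_conv_nth)
  have "j \<noteq> 0" "j \<noteq> 1" using j(2) yx y(2) unfolding x_def by metis+
  then have j2: "j \<ge> 2" by simp
  \<comment> \<open>The prefix of the path ending in \<open>y\<close> closes up through the edge
    from \<open>y\<close> back to \<open>x\<close>; \<open>j \<ge> 2\<close> gives it at least three
    vertices.\<close>
  define cs where "cs = take (Suc j) vs"
  have lcs: "length cs = Suc j" using j by (simp add: cs_def)
  have "is_cycle F cs"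
    unfolding is_cycle_def
  proof (intro conjI allI impI)
    show "3 \<le> length cs" using j2 lcs by simp
    show "distinct cs" using vs(1) by (simp add: cs_def P_def)
    fix i assume i: "i < length cs"
    show "{cs ! i, cs ! ((i + 1) mod length cs)} \<in> F"
    proof (cases "i = j")
      case True
      then show ?thesis using j y(1) lcs by (simp add: cs_def x_def nbrs_def)
    next
      case False
      then have "Suc i < length cs" using i lcs by simp
      then show ?thesis using vs(1) j lcs by (simp add: cs_def P_def path_def)
    qed
  qed
  then show False using \<open>forest F\<close> by (auto simp: forest_def)
qed

text \<open>Induction on the number of vertices: deleting a leaf removes one vertex and at most one
  edge.\<close>

lemma forest_card_le:
  assumes "simple_graph W F" "forest F"
  shows "card F \<le> card W"
  using assms
proof (induction "card W" arbitrary: W F)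
  case 0
  then have "F = {}" by (auto simp: simple_graph_def)
  then show ?case by simp
next
  case (Suc k)
  have finW: "finite W" using Suc.prems(1) by (rule simple_graph_finite)
  have "W \<noteq> {}" using Suc.hyps(2) by auto
  then obtain v where v: "v \<in> W" "card (nbrs F v) \<le> 1"
    using forest_has_leaf Suc.prems by blast
  define F' where "F' = {e \<in> F. v \<notin> e}"
  have "simple_graph (W - {v}) F'"
    using Suc.prems(1)
  proof (rule simple_graph_subgraph)
    fix e assume "e \<in> F'"
    moreover from this obtain x y where "x \<in> W" "y \<in> W" "e = {x, y}"
      using simple_graph_edgeE[OF Suc.prems(1), of e] unfolding F'_def by (metis mem_Collect_eq)
    ultimately show "e \<subseteq> W - {v}" by (auto simp: F'_def)
  qed (auto simp: F'_def)
  moreover have "forest F'" using Suc.prems(2) by (rule forest_subset) (auto simp: F'_def)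
  moreover have "k = card (W - {v})" using Suc.hyps(2) v(1) finW by simp
  ultimately have "card F' \<le> k" using Suc.hyps(1) by blast
  have "F = F' \<union> {e \<in> F. v \<in> e}" by (auto simp: F'_def)
  then have "card F \<le> card F' + card {e \<in> F. v \<in> e}" by (metis card_Un_le)
  also have "card {e \<in> F. v \<in> e} \<le> 1"
    using v(2) degree_eq_card_nbrs[OF Suc.prems(1)] by (simp add: degree_def)
  finally show ?case using \<open>card F' \<le> k\<close> Suc.hyps(2) by simp
qed

text \<open>The minimum in \<open>arboricity\<close> is attained because some partition into forests
  exists: give every edge a class of its own.\<close>

lemma arboricity_forests:
  assumes "simple_graph V E"
  obtains f :: "nat set \<Rightarrow> nat"
  where "\<And>e. e \<in> E \<Longrightarrow> f e < arboricity E"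
    and "\<And>i. i < arboricity E \<Longrightarrow> forest {e \<in> E. f e = i}"
proof -
  let ?P = "\<lambda>k. \<exists>f :: nat set \<Rightarrow> nat.
      (\<forall>e\<in>E. f e < k) \<and> (\<forall>i<k. forest {e\<in>E. f e = i})"
  obtain f :: "nat set \<Rightarrow> nat" and k where f: "f ` E = {i. i < k}" "inj_on f E"
    using finite_imp_inj_to_nat_seg[OF simple_graph_finite_edges[OF assms]] by blast
  have "forest {e \<in> E. f e = i}" for i
    unfolding forest_def
  proof
    define F where "F = {e \<in> E. f e = i}"
    assume "\<exists>vs. is_cycle {e \<in> E. f e = i} vs"
    then obtain vs where "is_cycle F vs" by (auto simp: F_def)
    then have l: "length vs \<ge> 3" "distinct vs"
      and e: "\<And>j. j < length vs \<Longrightarrow> {vs ! j, vs ! ((j + 1) mod length vs)} \<in> F"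
      unfolding is_cycle_def by blast+
    \<comment> \<open>A cycle has two different consecutive edges, whereas injectivity of
      \<open>f\<close> leaves at most one edge in each class.\<close>
    have "{vs ! 0, vs ! 1} \<in> F" using e[of 0] l(1) by fastforce
    moreover have "{vs ! 1, vs ! 2} \<in> F" using e[of 1] l(1) by (simp add: numeral_2_eq_2)
    ultimately have "{vs ! 0, vs ! 1} = {vs ! 1, vs ! 2}"
      using f(2) unfolding F_def inj_on_def by blast
    then have "vs ! 0 = vs ! 1 \<or> vs ! 0 = vs ! 2" by (auto simp: doubleton_eq_iff)
    moreover have "vs \<noteq> []" using l(1) by auto
    then have "vs ! 0 \<noteq> vs ! 1" "vs ! 0 \<noteq> vs ! 2"
      using nth_eq_iff_index_eq[OF l(2), of 0 1] nth_eq_iff_index_eq[OF l(2), of 0 2] l(1) by auto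
    ultimately show False by simp
  qed
  then have "?P k" using f(1) by (intro exI[of _ f]) auto
  then have "?P (arboricity E)" unfolding arboricity_def by (rule LeastI)
  then show ?thesis using that by blast
qed

text \<open>Each of the \<open>arboricity E\<close> forests, restricted to \<open>W\<close>, is a
  forest on \<open>W\<close> and so has at most \<open>card W\<close> edges.\<close>

lemma arboricity_induced_card_le:
  assumes sg: "simple_graph V E" and "W \<subseteq> V"
  shows "card {e \<in> E. e \<subseteq> W} \<le> arboricity E * card W"
proof -
  obtain f :: "nat set \<Rightarrow> nat" where f: "\<And>e. e \<in> E \<Longrightarrow> f e < arboricity E"
    "\<And>i. i < arboricity E \<Longrightarrow> forest {e \<in> E. f e = i}"
    using arboricity_forests[OF sg] by blast
  have "{e \<in> E. e \<subseteq> W} = (\<Union>i<arboricity E. {e \<in> E. f e = i \<and> e \<subseteq> W})" using f(1) by auto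
  then have "card {e \<in> E. e \<subseteq> W} \<le> (\<Sum>i<arboricity E. card {e \<in> E. f e = i \<and> e \<subseteq> W})"
    by (simp add: card_UN_le)
  also have "\<dots> \<le> (\<Sum>i<arboricity E. card W)"
  proof (rule sum_mono)
    fix i assume "i \<in> {..<arboricity E}"
    then have "forest {e \<in> E. f e = i \<and> e \<subseteq> W}"
      using f(2)[of i] by (auto intro: forest_subset)
    moreover have "simple_graph W {e \<in> E. f e = i \<and> e \<subseteq> W}"
      using sg \<open>W \<subseteq> V\<close> by (auto intro: simple_graph_subgraph)
    ultimately show "card {e \<in> E. f e = i \<and> e \<subseteq> W} \<le> card W" by (rule forest_card_le[rotated])
  qed
  finally show ?thesis by simp
qed

lemma arboricity_pos:
  assumes "simple_graph V E" "{u, v} \<in> E"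
  shows "arboricity E > 0"
proof -
  obtain f :: "nat set \<Rightarrow> nat" where "\<And>e. e \<in> E \<Longrightarrow> f e < arboricity E"
    using arboricity_forests[OF assms(1)] by blast
  then show ?thesis using assms(2) by fastforce
qed

section \<open>The H-partition\<close>

text \<open>Survival of the first \<open>i\<close> rounds of simultaneous peeling. Every natural
  number starts as active; those that are not vertices have no neighbours and drop out in round
  one.\<close>

fun active :: "nat \<Rightarrow> nat set set \<Rightarrow> nat \<Rightarrow> nat \<Rightarrow> bool" where
  "active A E 0 v = True"
| "active A E (Suc i) v = (active A E i v \<and> A < card {u \<in> nbrs E v. active A E i u})"

lemma active_antimono: "i \<le> j \<Longrightarrow> active A E j v \<Longrightarrow> active A E i v"
  by (induction j) (auto simp: le_Suc_eq)

text \<open>Double counting: an average vertex of a subgraph has degree at most twice the arboricity,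
  so at most half of the vertices have degree above four times the arboricity.\<close>
lemma active_halves:
  assumes sg: "simple_graph V E" and a: "arboricity E > 0" and A: "A = 4 * arboricity E"
  shows "2 * card {v \<in> V. active A E (Suc i) v} \<le> card {v \<in> V. active A E i v}"
proof -
  let ?a = "arboricity E"
  define W where "W = {v \<in> V. active A E i v}"
  define W' where "W' = {v \<in> V. active A E (Suc i) v}"
  define F where "F = {e \<in> E. e \<subseteq> W}"
  have "finite V" using sg by (rule simple_graph_finite)
  then have fin: "finite W" "finite W'" by (auto simp: W_def W'_def)
  have finF: "finite F" using simple_graph_finite_edges[OF sg] by (simp add: F_def)
  have "W' \<subseteq> W" by (auto simp: W_def W'_def)
  have sgF: "simple_graph W F" using sg by (rule simple_graph_subgraph) (auto simp: F_def W_def)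
  have "A \<le> card {e \<in> F. v \<in> e}" if "v \<in> W'" for v
  proof -
    have "v \<in> W" using that \<open>W' \<subseteq> W\<close> by blast
    then have "{u \<in> nbrs E v. active A E i u} = nbrs F v"
      using simple_graph_nbrsD[OF sg] by (auto simp: nbrs_def F_def W_def)
    then show ?thesis
      using that degree_eq_card_nbrs[OF sgF, of v] by (simp add: W'_def degree_def)
  qed
  then have "card W' * A \<le> (\<Sum>v\<in>W'. card {e \<in> F. v \<in> e})"
    using sum_bounded_below[of W' A] by simp
  also have "\<dots> \<le> (\<Sum>v\<in>W. card {e \<in> F. v \<in> e})"
    using \<open>W' \<subseteq> W\<close> fin by (intro sum_mono2) auto
  also have "\<dots> = 2 * card F"
  proof (rule sum_multicount[OF fin(1) finF], intro ballI)
    fix e assume "e \<in> F"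
    then obtain u v where "u \<noteq> v" "u \<in> W" "v \<in> W" "e = {u, v}"
      using simple_graph_edgeE[OF sgF] by metis
    moreover from this have "{x \<in> W. x \<in> e} = {u, v}" by auto
    ultimately show "card {x \<in> W. x \<in> e} = 2" by simp
  qed
  also have "\<dots> \<le> 2 * (?a * card W)"
    using arboricity_induced_card_le[OF sg, of W] by (simp add: F_def W_def)
  \<comment> \<open>With \<open>A\<close> equal to four times the arboricity, cancelling twice the
    arboricity leaves exactly the halving.\<close>
  finally have "(2 * ?a) * (2 * card W') \<le> (2 * ?a) * card W" by (simp add: A algebra_simps)
  then show ?thesis using a by (simp add: W_def W'_def)
qed

text \<open>After \<open>L\<close> halvings fewer than one vertex is left.\<close>

lemma active_exhausted:
  assumes sg: "simple_graph V E" and a: "arboricity E > 0" and A: "A = 4 * arboricity E"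
    and L: "card V < 2 ^ L" "L > 0"
  shows "\<not> active A E L v"
proof
  assume act: "active A E L v"
  have fin: "finite V" using sg by (rule simple_graph_finite)
  have *: "2 ^ i * card {v \<in> V. active A E i v} \<le> card V" for i
  proof (induction i)
    case 0
    then show ?case using fin by (simp add: card_mono)
  next
    case (Suc i)
    have "2 ^ Suc i * card {v \<in> V. active A E (Suc i) v} \<le> 2 ^ i * card {v \<in> V. active A E i v}"
      using active_halves[OF sg a A, of i] by (simp del: active.simps)
    then show ?case using Suc by linarith
  qed
  \<comment> \<open>The count only concerns \<open>V\<close>; other numbers vanish in the first
    round, which takes place because \<open>L > 0\<close>.\<close>
  have "v \<in> V"
  proof (rule ccontr)
    assume v: "v \<notin> V"
    then have "nbrs E v = {}" using simple_graph_nbrsD(2)[OF sg] by blast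
    then have "\<not> active A E (Suc 0) v" by simp
    then show False using act active_antimono[of "Suc 0" L A E v] L(2) by force
  qed
  then have "card {v \<in> V. active A E L v} \<ge> 1"
    using act fin by (auto simp: Suc_le_eq card_gt_0_iff)
  then have "2 ^ L * 1 \<le> 2 ^ L * card {v \<in> V. active A E L v}" by (intro mult_le_mono2)
  then show False using *[of L] L(1) by linarith
qed

section \<open>Locality\<close>

text \<open>Equality of the views of radius \<open>t\<close> around \<open>v\<close>. Walking along
  \<open>nbrs E\<close> only is symmetric, since the base case makes the neighbour sets in both
  graphs equal.\<close>

fun indist :: "nat \<Rightarrow> nat set set \<Rightarrow> nat set set \<Rightarrow> nat \<Rightarrow> bool" where
  "indist 0 E E' v \<longleftrightarrow> nbrs E v = nbrs E' v"
| "indist (Suc t) E E' v \<longleftrightarrow> indist t E E' v \<and> (\<forall>u\<in>nbrs E v. indist t E E' u)"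

lemma indist_mono: "s \<le> t \<Longrightarrow> indist t E E' v \<Longrightarrow> indist s E E' v"
  by (induction t) (auto simp: le_Suc_eq)

lemma indist_nbrs: "indist t E E' v \<Longrightarrow> nbrs E v = nbrs E' v"
  using indist_mono[of 0 t] by simp

lemma indist_nbr: "indist (Suc t) E E' v \<Longrightarrow> u \<in> nbrs E v \<Longrightarrow> indist t E E' u"
  by simp

text \<open>In the universal algorithm a vertex remembers everything it has heard and forwards it.\<close>

definition gather_init :: "nat \<Rightarrow> nat set \<Rightarrow> nat" where
  "gather_init v N = prod_encode (v, set_encode N)"

definition gather_step :: "nat \<Rightarrow> (nat \<Rightarrow> nat option) \<Rightarrow> nat" where
  "gather_step s M = prod_encode (s, set_encode {prod_encode (u, m) |u m. M u = Some m})"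

abbreviation gather :: "nat set set \<Rightarrow> nat \<Rightarrow> nat \<Rightarrow> nat" where
  "gather \<equiv> run gather_init gather_step (\<lambda>s u. s)"

lemma set_encode_eqD: "finite A \<Longrightarrow> finite B \<Longrightarrow> set_encode A = set_encode B \<Longrightarrow> A = B"
  using set_encode_eq by blast

text \<open>The encodings are injective on finite data, so the state after \<open>t\<close> rounds
  determines the vertex and its view of radius \<open>t\<close>.\<close>

lemma gather_eqD:
  assumes fin: "\<And>w. finite (nbrs E w)" "\<And>w. finite (nbrs E' w)"
    and "gather E t v = gather E' t v'"
  shows "v = v' \<and> indist t E E' v"
  using assms(3)
proof (induction t arbitrary: v v')
  case 0
  then show ?case using fin by (auto simp: gather_init_def dest: set_encode_eqD)
next
  case (Suc t)
  let ?S = "\<lambda>E v. {prod_encode (u, m) |u m.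
    (if {u, v} \<in> E then Some (gather E t u) else None) = Some m}"
  have S: "?S E v = (\<lambda>u. prod_encode (u, gather E t u)) ` nbrs E v" for E v
    by (auto simp: nbrs_def split: if_splits)
  have "gather E (Suc t) v = prod_encode (gather E t v, set_encode (?S E v))" for E v
    unfolding run.simps(2) gather_step_def[of "gather E t v"] ..
  then have "prod_encode (gather E t v, set_encode (?S E v)) =
      prod_encode (gather E' t v', set_encode (?S E' v'))"
    using Suc.prems by (simp only:)
  then have 1: "gather E t v = gather E' t v'"
    and 2: "set_encode (?S E v) = set_encode (?S E' v')"
    unfolding prod_encode_eq prod.inject by blast+
  have v: "v' = v" "indist t E E' v" using Suc.IH[OF 1] by auto
  have "?S E v = ?S E' v'" using 2 fin unfolding S by (intro set_encode_eqD) auto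
  then have img: "(\<lambda>u. prod_encode (u, gather E t u)) ` nbrs E v =
      (\<lambda>u. prod_encode (u, gather E' t u)) ` nbrs E' v'" unfolding S .
  have "indist t E E' u" if "u \<in> nbrs E v" for u
  proof -
    \<comment> \<open>The sender's ID stored with each message allows the two sets to be compared
      neighbour by neighbour.\<close>
    have "prod_encode (u, gather E t u) \<in> (\<lambda>u. prod_encode (u, gather E' t u)) ` nbrs E' v'"
      using that unfolding img[symmetric] by blast
    then have "gather E t u = gather E' t u" by auto
    then show ?thesis using Suc.IH by blast
  qed
  then show ?case using v by simp
qed

lemma indist_active:
  "indist t E E' v \<Longrightarrow> i \<le> t \<Longrightarrow> active A E i v = active A E' i v"
proof (induction i arbitrary: t v)
  case (Suc i)
  then obtain s where t: "t = Suc s" "i \<le> s" by (cases t) auto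
  have "active A E i v = active A E' i v" using Suc.IH[of t v] Suc.prems by simp
  moreover have "active A E i u = active A E' i u" if "u \<in> nbrs E v" for u
    using Suc.IH[of s u] Suc.prems(1) that t by simp
  then have "{u \<in> nbrs E v. active A E i u} = {u \<in> nbrs E' v. active A E' i u}"
    using indist_nbrs[OF Suc.prems(1)] by auto
  ultimately show ?case by simp
qed simp

section \<open>Greedy colouring\<close>

text \<open>The sequential greedy colouring in the order of the keys \<open>k\<close>. Elements with
  equal keys ignore each other, so conflicting elements must have different keys.\<close>

function greedy :: "('a \<Rightarrow> nat) \<Rightarrow> ('a \<Rightarrow> 'a set) \<Rightarrow> 'a \<Rightarrow> nat" where
  "greedy k N x = (LEAST c. c \<notin> greedy k N ` {y \<in> N x. k y < k x})"
  by auto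
termination by (relation "measure (\<lambda>(k, N, x). k x)") auto

declare greedy.simps [simp del]

text \<open>Pigeonhole: the \<open>card S + 1\<close> numbers up to \<open>card S\<close> cannot all
  lie in \<open>S\<close>.\<close>

lemma Least_not_in_finite:
  fixes S :: "nat set"
  assumes "finite S"
  shows "(LEAST c. c \<notin> S) \<notin> S" "(LEAST c. c \<notin> S) \<le> card S"
proof -
  have "\<not> {..card S} \<subseteq> S" using card_mono[OF assms, of "{..card S}"] by auto
  then obtain c where c: "c \<notin> S" "c \<le> card S" by auto
  show "(LEAST c. c \<notin> S) \<notin> S" using c(1) by (rule LeastI)
  show "(LEAST c. c \<notin> S) \<le> card S" using Least_le[of "\<lambda>c. c \<notin> S" c] c by simp
qed

lemma greedy_neq:
  assumes "finite (N x)" "y \<in> N x" "k y < k x"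
  shows "greedy k N y \<noteq> greedy k N x"
proof -
  have "greedy k N x \<notin> greedy k N ` {y \<in> N x. k y < k x}"
    unfolding greedy.simps[of k N x] using assms(1) by (intro Least_not_in_finite) simp
  moreover have "greedy k N y \<in> greedy k N ` {y \<in> N x. k y < k x}" using assms(2,3) by blast
  ultimately show ?thesis by metis
qed

lemma greedy_le:
  assumes "finite (N x)"
  shows "greedy k N x \<le> card {y \<in> N x. k y < k x}"
proof -
  have fin: "finite {y \<in> N x. k y < k x}" using assms by simp
  have "greedy k N x \<le> card (greedy k N ` {y \<in> N x. k y < k x})"
    unfolding greedy.simps[of k N x] using fin by (intro Least_not_in_finite) simp
  also have "\<dots> \<le> card {y \<in> N x. k y < k x}" using fin by (rule card_image_le)
  finally show ?thesis .
qed

text \<open>Serves to compare two graphs: the keys may differ as long as the same conflicting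
  elements come earlier.\<close>

lemma greedy_cong:
  assumes "{y \<in> N x. k y < k x} = {y \<in> N' x. k' y < k' x}"
    and "\<And>y. y \<in> N x \<Longrightarrow> k y < k x \<Longrightarrow> greedy k N y = greedy k' N' y"
  shows "greedy k N x = greedy k' N' x"
proof -
  have "greedy k N ` {y \<in> N x. k y < k x} = greedy k' N' ` {y \<in> N' x. k' y < k' x}"
    using assms by (intro image_cong) auto
  then show ?thesis unfolding greedy.simps[of k N x] greedy.simps[of k' N' x] by (rule arg_cong)
qed

section \<open>Phases\<close>

text \<open>If edges of one layer share the split bit and point to the endpoint having a 1 there, no
  vertex is both a head and a tail.\<close>

definition split_bit :: "nat \<Rightarrow> nat \<Rightarrow> nat" where
  "split_bit v u = (LEAST b. bit v b \<noteq> bit u b)"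

lemma split_bit_commute: "split_bit v u = split_bit u v"
  unfolding split_bit_def by metis

lemma bit_split_bit: "v \<noteq> u \<Longrightarrow> bit v (split_bit v u) \<noteq> bit u (split_bit v u)"
  unfolding split_bit_def by (rule LeastI_ex) (metis bit_eq_iff)

lemma split_bit_less:
  assumes "v \<noteq> u" "v < 2 ^ B" "u < 2 ^ B"
  shows "split_bit v u < B"
proof (rule ccontr)
  assume "\<not> split_bit v u < B"
  then have "(2 :: nat) ^ B \<le> 2 ^ split_bit v u" by (intro power_increasing) auto
  then have "v < 2 ^ split_bit v u" "u < 2 ^ split_bit v u" using assms(2,3) by linarith+
  then show False using bit_split_bit[OF assms(1)] by (simp add: bit_iff_odd)
qed

text \<open>The position of an element in a finite set of numbers identifies it; thus
  \<open>rank\<close> separates the out-edges of a vertex.\<close>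

lemma card_less_inj:
  fixes S :: "nat set"
  assumes "finite S" "x \<in> S" "y \<in> S" "card {w \<in> S. w < x} = card {w \<in> S. w < y}"
  shows "x = y"
proof -
  have *: "\<not> p < q" if "p \<in> S" "card {w \<in> S. w < p} = card {w \<in> S. w < q}" for p q
  proof
    assume "p < q"
    then have "{w \<in> S. w < p} \<subset> {w \<in> S. w < q}" using that(1) by auto
    then have "card {w \<in> S. w < p} < card {w \<in> S. w < q}" using assms(1) by (intro psubset_card_mono) auto
    then show False using that(2) by simp
  qed
  show ?thesis using *[OF assms(2,4)] *[OF assms(3) assms(4)[symmetric]] by simp
qed

text \<open>The parameters are the degree bound \<open>A\<close> and the number \<open>L\<close> of layers of the H-partition,
  the number \<open>B\<close> of bits of an ID, and a strict upper bound \<open>M\<close> on the IDs.\<close>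
locale colouring_params =
  fixes A L B M :: nat
begin

text \<open>The guard \<open>i < L\<close> provides the default \<open>L\<close> for a vertex never
  peeled and makes the level depend on the first \<open>L\<close> rounds only.\<close>

definition level :: "nat set set \<Rightarrow> nat \<Rightarrow> nat" where
  "level E v = (LEAST i. i < L \<longrightarrow> \<not> active A E (Suc i) v)"

definition upper_nbrs :: "nat set set \<Rightarrow> nat \<Rightarrow> nat set" where
  "upper_nbrs E v = {u \<in> nbrs E v. level E v \<le> level E u}"

definition arc :: "nat set set \<Rightarrow> nat \<Rightarrow> nat \<Rightarrow> bool" where
  "arc E v u \<longleftrightarrow> u \<in> nbrs E v \<and>
     (level E v < level E u \<or> level E v = level E u \<and> bit u (split_bit v u))"

text \<open>Edges inside a layer come first, ordered by the position of the first bit in which the IDs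
  of their endpoints differ; then come the edges between layers, from the top layer downwards.\<close>
definition stage :: "nat set set \<Rightarrow> nat \<Rightarrow> nat \<Rightarrow> nat" where
  "stage E v u = (if level E v = level E u then split_bit v u else B + (L - Suc (level E v)))"

definition rank :: "nat set set \<Rightarrow> nat \<Rightarrow> nat \<Rightarrow> nat" where
  "rank E v u = card {w \<in> upper_nbrs E v. w < u}"

text \<open>Lexicographic code of stage and rank, since ranks of arcs lie below
  \<open>A\<close>.\<close>

definition phase :: "nat set set \<Rightarrow> nat \<Rightarrow> nat \<Rightarrow> nat" where
  "phase E v u = stage E v u * A + rank E v u"

text \<open>Lexicographic code of phase and tail, since IDs lie below \<open>M\<close>. Arcs of one
  phase that meet share their head, so the tail tells them apart.\<close>

definition key :: "nat set set \<Rightarrow> nat \<times> nat \<Rightarrow> nat" where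
  "key E = (\<lambda>(v, u). phase E v u * M + v)"

text \<open>An arc conflicts with itself here, which is harmless as \<open>greedy\<close> looks at
  strictly smaller keys.\<close>

definition conflicts :: "nat set set \<Rightarrow> nat \<times> nat \<Rightarrow> (nat \<times> nat) set" where
  "conflicts E = (\<lambda>(v, u). {(v', u'). arc E v' u' \<and> {v', u'} \<inter> {v, u} \<noteq> {}})"

definition arc_colour :: "nat set set \<Rightarrow> nat \<times> nat \<Rightarrow> nat" where
  "arc_colour E = greedy (key E) (conflicts E)"

definition edge_arc :: "nat set set \<Rightarrow> nat \<Rightarrow> nat \<Rightarrow> nat \<times> nat" where
  "edge_arc E v u = (if arc E v u then (v, u) else (u, v))"

definition edge_colour :: "nat set set \<Rightarrow> nat \<Rightarrow> nat \<Rightarrow> nat" where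
  "edge_colour E v u = arc_colour E (edge_arc E v u)"

section \<open>Locality of levels, orientation and phases\<close>

lemma indist_level:
  assumes "indist L E E' v"
  shows "level E v = level E' v"
proof -
  have "(i < L \<longrightarrow> \<not> active A E (Suc i) v) = (i < L \<longrightarrow> \<not> active A E' (Suc i) v)" for i
    using indist_active[OF assms, of "Suc i" A] by auto
  then show ?thesis unfolding level_def by simp
qed

lemma indist_upper_nbrs:
  assumes "indist (Suc L) E E' v"
  shows "upper_nbrs E v = upper_nbrs E' v"
proof -
  have "level E v = level E' v" using indist_level indist_mono[OF _ assms, of L] by simp
  moreover have "level E u = level E' u" if "u \<in> nbrs E v" for u
    using indist_level indist_nbr[OF assms that] by blast
  ultimately show ?thesis unfolding upper_nbrs_def using indist_nbrs[OF assms] by auto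
qed

text \<open>One unit of radius reaches the other endpoint, whichever endpoint \<open>x\<close> is,
  and one more reaches the levels of the neighbours of that endpoint.\<close>

lemma indist_arc_phase:
  assumes "indist (Suc (Suc L)) E E' x" "x = v \<or> x = u" "u \<in> nbrs E v"
  shows "arc E v u = arc E' v u" "phase E v u = phase E' v u"
proof -
  have x: "indist (Suc L) E E' x" using indist_mono[OF _ assms(1), of "Suc L"] by simp
  have "v \<in> nbrs E u" using assms(3) by (simp add: nbrs_def insert_commute)
  then have ind: "indist (Suc L) E E' v" "indist (Suc L) E E' u"
    using assms x indist_nbr[OF assms(1)] by blast+
  then have lev: "level E v = level E' v" "level E u = level E' u"
    by (auto intro!: indist_level elim: indist_mono[rotated])
  show "arc E v u = arc E' v u"
    unfolding arc_def using lev indist_nbrs[OF ind(1)] by simp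
  show "phase E v u = phase E' v u"
    unfolding phase_def stage_def rank_def using lev indist_upper_nbrs[OF ind(1)] by simp
qed

end

text \<open>Arboricity enters the colouring only through \<open>exhausted\<close>: peeling with
  threshold \<open>A\<close> ends within \<open>L\<close> rounds.\<close>

locale layered_graph = colouring_params +
  fixes V :: "nat set" and E :: "nat set set"
  assumes graph: "simple_graph V E"
    and exhausted: "\<not> active A E L v"
    and ids: "V \<subseteq> {..<M}" "M \<le> 2 ^ B"
begin

section \<open>The orientation and the disjoint stars of a phase\<close>

lemma nbrs_commute: "u \<in> nbrs E v \<longleftrightarrow> v \<in> nbrs E u"
  by (simp add: nbrs_def insert_commute)

lemma active_level: "active A E (level E v) v"
proof (cases "level E v")
  case (Suc i)
  then have "\<not> (i < L \<longrightarrow> \<not> active A E (Suc i) v)"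
    unfolding level_def by (intro not_less_Least) simp
  then show ?thesis using Suc by simp
qed simp

lemma level_less: "level E v < L"
proof -
  have "level E v \<le> L" unfolding level_def by (rule Least_le) simp
  moreover have "level E v \<noteq> L" using active_level exhausted by metis
  ultimately show ?thesis by simp
qed

lemma not_active_Suc_level: "\<not> active A E (Suc (level E v)) v"
proof -
  have "level E v < L \<longrightarrow> \<not> active A E (Suc (level E v)) v"
    unfolding level_def by (rule LeastI[of _ L]) simp
  then show ?thesis using level_less by simp
qed

lemma finite_upper_nbrs: "finite (upper_nbrs E v)"
  unfolding upper_nbrs_def using finite_nbrs[OF graph] by simp

text \<open>Neighbours in the same or a higher layer were still active when \<open>v\<close> was
  peeled, and \<open>v\<close> was peeled because at most \<open>A\<close> neighbours were.\<close>

lemma card_upper_nbrs: "card (upper_nbrs E v) \<le> A"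
proof -
  have "card {u \<in> nbrs E v. active A E (level E v) u} \<le> A"
    using not_active_Suc_level[of v] active_level[of v] by simp
  moreover have "upper_nbrs E v \<subseteq> {u \<in> nbrs E v. active A E (level E v) u}"
    unfolding upper_nbrs_def using active_antimono active_level by blast
  then have "card (upper_nbrs E v) \<le> card {u \<in> nbrs E v. active A E (level E v) u}"
    using finite_nbrs[OF graph] by (intro card_mono) auto
  ultimately show ?thesis by simp
qed

lemma arcD:
  assumes "arc E v u"
  shows "u \<in> upper_nbrs E v" "v \<noteq> u" "v < M" "u < M" "level E v \<le> level E u"
    "level E v = level E u \<Longrightarrow> bit u (split_bit v u) \<and> \<not> bit v (split_bit v u)"
proof -
  have nb: "u \<in> nbrs E v" using assms by (simp add: arc_def)
  show "u \<in> upper_nbrs E v" "level E v \<le> level E u"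
    using assms by (auto simp: arc_def upper_nbrs_def)
  show ne: "v \<noteq> u" "v < M" "u < M" using simple_graph_nbrsD[OF graph nb] ids(1) by auto
  show "bit u (split_bit v u) \<and> \<not> bit v (split_bit v u)" if "level E v = level E u"
    using assms that bit_split_bit[OF ne(1)] by (simp add: arc_def)
qed

lemma arc_or: "u \<in> nbrs E v \<Longrightarrow> arc E v u \<or> arc E u v"
  using bit_split_bit[of v u] simple_graph_nbrsD(3)[OF graph, of u v] nbrs_commute[of u v]
  by (auto simp: arc_def split_bit_commute[of u v])

lemma arc_asym:
  assumes "arc E v u"
  shows "\<not> arc E u v"
proof
  assume "arc E u v"
  moreover from this have "level E v = level E u" using arcD(5) assms by (metis le_antisym)
  ultimately show False using arcD(6)[OF assms] by (simp add: arc_def split_bit_commute[of u v])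
qed

lemma stage_less:
  assumes "arc E v u"
  shows "stage E v u < B + L"
proof -
  have "v < 2 ^ B" "u < 2 ^ B" using arcD(3,4)[OF assms] ids(2) by linarith+
  then have "split_bit v u < B" using split_bit_less arcD(2)[OF assms] by blast
  then show ?thesis using level_less[of v] by (auto simp: stage_def)
qed

lemma stage_same_layer:
  assumes "arc E v u"
  shows "stage E v u < B \<longleftrightarrow> level E v = level E u"
proof -
  have "v < 2 ^ B" "u < 2 ^ B" using arcD(3,4)[OF assms] ids(2) by linarith+
  then have "split_bit v u < B" using split_bit_less arcD(2)[OF assms] by blast
  then show ?thesis by (auto simp: stage_def)
qed

lemma rank_less:
  assumes "arc E v u"
  shows "rank E v u < A"
proof -
  have "{w \<in> upper_nbrs E v. w < u} \<subset> upper_nbrs E v" using arcD(1)[OF assms] by auto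
  then have "rank E v u < card (upper_nbrs E v)"
    unfolding rank_def using finite_upper_nbrs by (rule psubset_card_mono[rotated])
  then show ?thesis using card_upper_nbrs by (rule less_le_trans)
qed

lemma phase_div:
  assumes "arc E v u"
  shows "phase E v u div A = stage E v u" "phase E v u mod A = rank E v u"
  using rank_less[OF assms] by (simp_all add: phase_def)

lemma phase_less:
  assumes "arc E v u"
  shows "phase E v u < (B + L) * A"
proof -
  have "Suc (stage E v u) * A \<le> (B + L) * A" using stage_less[OF assms] by (intro mult_le_mono1) simp
  then show ?thesis using rank_less[OF assms] by (simp add: phase_def)
qed

text \<open>Inside a layer, \<open>x\<close> would need both a 1 and a 0 at the common split bit.
  Between layers, equal stages put the tails \<open>x\<close> and \<open>w\<close> on one level, yet
  \<open>w\<close> lies strictly below its head \<open>x\<close>.\<close>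

lemma same_phase_not_head:
  assumes "arc E x u" "arc E w x" "phase E x u = phase E w x"
  shows False
proof -
  have st: "stage E x u = stage E w x" using phase_div(1) assms by metis
  show False
  proof (cases "stage E x u < B")
    case True
    then have "level E x = level E u" "level E w = level E x"
      using st stage_same_layer assms by metis+
    then have "bit x (split_bit w x)" "\<not> bit x (split_bit x u)" "split_bit x u = split_bit w x"
      using arcD(6)[OF assms(1)] arcD(6)[OF assms(2)] st by (auto simp: stage_def)
    then show False by simp
  next
    case False
    then have "level E x \<noteq> level E u" "level E w \<noteq> level E x"
      using st stage_same_layer assms by metis+
    then have "L - Suc (level E x) = L - Suc (level E w)" "level E w < level E x"
      using st arcD(5)[OF assms(2)] by (auto simp: stage_def)
    then show False using level_less[of x] by simp
  qed
qed

text \<open>Heads never meet tails within a phase, and a common tail with equal rank forces a common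
  head. So each phase consists of disjoint stars.\<close>

lemma same_phase_same_head:
  assumes "arc E v u" "arc E v' u'" "{v', u'} \<inter> {v, u} \<noteq> {}" "phase E v u = phase E v' u'"
  shows "u' = u"
proof -
  have "v' = v \<or> v' = u \<or> u' = v \<or> u' = u" using assms(3) by auto
  moreover have "v' \<noteq> u" "u' \<noteq> v" using same_phase_not_head assms by metis+
  moreover have "u' = u" if "v' = v"
  proof (rule card_less_inj)
    show "finite (upper_nbrs E v)" by (rule finite_upper_nbrs)
    show "u' \<in> upper_nbrs E v" "u \<in> upper_nbrs E v" using arcD(1) assms(1,2) that by auto
    have "rank E v u' = rank E v u" using phase_div(2) assms(1,2,4) that by metis
    then show "card {w \<in> upper_nbrs E v. w < u'} = card {w \<in> upper_nbrs E v. w < u}"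
      by (simp add: rank_def)
  qed
  ultimately show ?thesis by blast
qed

lemma key_less_iff:
  assumes "arc E v u" "arc E v' u'"
  shows "key E (v', u') < key E (v, u) \<longleftrightarrow>
    phase E v' u' < phase E v u \<or> phase E v' u' = phase E v u \<and> v' < v"
proof -
  have *: "p * M + a < q * M + b" if "p < q" "a < M" for p q a b :: nat
  proof -
    have "Suc p * M \<le> q * M" using that(1) by (intro mult_le_mono1) simp
    then show ?thesis using that(2) by simp
  qed
  have "v < M" "v' < M" using assms arcD(3) by auto
  then show ?thesis
    using *[of "phase E v' u'" "phase E v u" v' v] *[of "phase E v u" "phase E v' u'" v v']
    by (cases "phase E v u" "phase E v' u'" rule: linorder_cases) (auto simp: key_def)
qed

section \<open>Properness and number of colours\<close>

lemma finite_conflicts: "finite (conflicts E e)"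
proof (rule finite_subset)
  show "conflicts E e \<subseteq> {..<M} \<times> {..<M}" using arcD(3,4) by (auto simp: conflicts_def)
qed simp

text \<open>Equal keys would mean equal phase and tail, hence equal head as well. So one of two
  conflicting arcs comes first, and the other avoids its colour.\<close>

lemma arc_colour_neq:
  assumes e: "arc E v u" "arc E v' u'" "{v', u'} \<inter> {v, u} \<noteq> {}" "(v', u') \<noteq> (v, u)"
  shows "arc_colour E (v', u') \<noteq> arc_colour E (v, u)"
proof -
  have c: "(v', u') \<in> conflicts E (v, u)" "(v, u) \<in> conflicts E (v', u')"
    using e by (auto simp: conflicts_def)
  have "key E (v', u') \<noteq> key E (v, u)"
  proof
    assume eq: "key E (v', u') = key E (v, u)"
    then have "phase E v u = phase E v' u'" "v' = v"
      using key_less_iff[OF e(1,2)] key_less_iff[OF e(2,1)] by auto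
    then show False using same_phase_same_head[OF e(1-3)] e(4) by simp
  qed
  then show ?thesis
    using greedy_neq[where N = "conflicts E" and k = "key E", OF finite_conflicts] c
    unfolding arc_colour_def by (metis nat_neq_iff)
qed

text \<open>When the arc from \<open>v\<close> to \<open>u\<close> is coloured, the coloured edges at \<open>v\<close> all lead to
  \<open>upper_nbrs E v\<close>.\<close>
lemma upper_nbrs_of_phase_le:
  assumes e: "arc E v u" and f: "arc E v' u'" "phase E v' u' \<le> phase E v u"
    and x: "v' = v \<and> w = u' \<or> u' = v \<and> w = v'"
  shows "w \<in> upper_nbrs E v"
proof (cases "v' = v \<and> w = u'")
  case True
  then show ?thesis using arcD(1)[OF f(1)] by simp
next
  case False
  then have w: "u' = v" "w = v'" using x by auto
  have st: "stage E w v \<le> stage E v u"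
    using div_le_mono[OF f(2), of A] phase_div(1) e f(1) w by metis
  have wv: "arc E w v" using f(1) w by simp
  have "level E v \<le> level E w"
  proof (rule ccontr)
    assume "\<not> level E v \<le> level E w"
    \<comment> \<open>An arc from a lower layer into \<open>v\<close> is treated after every
      out-edge of \<open>v\<close>: stages between layers follow those inside layers and run from
      the top downwards.\<close>
    then have lt: "level E w < level E v" by simp
    then have "B \<le> stage E w v" using stage_same_layer[OF wv] by simp
    then have "level E v \<noteq> level E u" using st stage_same_layer[OF e] by simp
    then show False using st lt level_less[of v] by (simp add: stage_def)
  qed
  moreover have "w \<in> nbrs E v" using wv nbrs_commute by (auto simp: arc_def)
  ultimately show ?thesis by (simp add: upper_nbrs_def)
qed

lemma arc_colour_le:
  assumes e: "arc E v u"
  shows "arc_colour E (v, u) \<le> A + max_degree V E"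
proof -
  let ?S = "{y \<in> conflicts E (v, u). key E y < key E (v, u)}"
  \<comment> \<open>Earlier conflicting edges are indexed by their far endpoint, in either
    orientation: upper neighbours at the tail, arbitrary neighbours at the head.\<close>
  have "?S \<subseteq> edge_arc E v ` upper_nbrs E v \<union> edge_arc E u ` nbrs E u"
  proof
    fix y assume "y \<in> ?S"
    then obtain v' u' where y: "y = (v', u')" "arc E v' u'" "{v', u'} \<inter> {v, u} \<noteq> {}"
      "key E (v', u') < key E (v, u)" by (auto simp: conflicts_def)
    have ph: "phase E v' u' \<le> phase E v u" using y(4) key_less_iff[OF e y(2)] by auto
    have arcs: "y = edge_arc E v' u'" "y = edge_arc E u' v'"
      using y(1,2) arc_asym by (auto simp: edge_arc_def)
    have nb: "u' \<in> nbrs E v'" "v' \<in> nbrs E u'"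
      using y(2) nbrs_commute by (auto simp: arc_def)
    consider "v' = v" | "u' = v" | "v' = u" | "u' = u" using y(3) by auto
    then show "y \<in> edge_arc E v ` upper_nbrs E v \<union> edge_arc E u ` nbrs E u"
    proof cases
      case 1
      then show ?thesis using arcs(1) upper_nbrs_of_phase_le[OF e y(2) ph, of u'] by auto
    next
      case 2
      then show ?thesis using arcs(2) upper_nbrs_of_phase_le[OF e y(2) ph, of v'] by auto
    next
      case 3
      then show ?thesis using arcs(1) nb by auto
    next
      case 4
      then show ?thesis using arcs(2) nb by auto
    qed
  qed
  then have "card ?S \<le> card (edge_arc E v ` upper_nbrs E v \<union> edge_arc E u ` nbrs E u)"
    using finite_upper_nbrs finite_nbrs[OF graph] by (intro card_mono) auto
  also have "\<dots> \<le> card (edge_arc E v ` upper_nbrs E v) + card (edge_arc E u ` nbrs E u)"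
    by (rule card_Un_le)
  also have "\<dots> \<le> card (upper_nbrs E v) + card (nbrs E u)"
    using finite_upper_nbrs finite_nbrs[OF graph] by (intro add_mono card_image_le)
  also have "\<dots> \<le> A + max_degree V E"
  proof (intro add_mono card_upper_nbrs)
    have uV: "u \<in> V" using e simple_graph_nbrsD(1)[OF graph, of u v] by (simp add: arc_def)
    then have "degree E u \<le> Max (degree E ` V)" using simple_graph_finite[OF graph] by simp
    then show "card (nbrs E u) \<le> max_degree V E"
      using uV degree_eq_card_nbrs[OF graph, of u] by (auto simp: max_degree_def)
  qed
  finally show ?thesis
    using greedy_le[where N = "conflicts E" and k = "key E" and x = "(v, u)", OF finite_conflicts]
    unfolding arc_colour_def by linarith
qed

lemma edge_arc_commute: "u \<in> nbrs E v \<Longrightarrow> edge_arc E v u = edge_arc E u v"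
  using arc_or[of u v] arc_asym[of v u] by (auto simp: edge_arc_def)

lemma edge_arc_cases:
  assumes "u \<in> nbrs E v"
  obtains "edge_arc E v u = (v, u)" "arc E v u" | "edge_arc E v u = (u, v)" "arc E u v"
  using arc_or[OF assms] unfolding edge_arc_def by metis

lemma edge_colour_neq:
  assumes "u \<in> nbrs E v" "w \<in> nbrs E v" "u \<noteq> w"
  shows "edge_colour E v u \<noteq> edge_colour E v w"
  unfolding edge_colour_def
  by (rule edge_arc_cases[OF assms(1)]; rule edge_arc_cases[OF assms(2)];
    simp; intro arc_colour_neq; use assms(3) in auto)

lemma edge_colour_le:
  assumes "u \<in> nbrs E v"
  shows "edge_colour E v u \<le> A + max_degree V E"
  unfolding edge_colour_def by (rule edge_arc_cases[OF assms]) (simp_all add: arc_colour_le)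

end

text \<open>All arcs of one phase that meet an arc have the same head, so each phase costs two rounds.\<close>
lemma arc_colour_local:
  fixes A L B M :: nat
  assumes "layered_graph A L B M V E" "layered_graph A L B M V' E'"
    and "indist (Suc (Suc L) + 2 * p) E E' x" "x = v \<or> x = u"
    and "colouring_params.arc A L E v u" "colouring_params.phase A L B E v u < p"
  shows "colouring_params.arc_colour A L B M E (v, u) = colouring_params.arc_colour A L B M E' (v, u)"
proof -
  interpret G: layered_graph A L B M V E by fact
  interpret G': layered_graph A L B M V' E' by fact
  let ?t = "\<lambda>p. Suc (Suc L) + 2 * p"
  show ?thesis
    using assms(3-6)
  proof (induction p arbitrary: x v u)
    case (Suc p)
    show ?case
    proof (cases "G.phase E v u < p")
      case True
      have "indist (?t p) E E' x" using Suc.prems(1) by (rule indist_mono[rotated]) simp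
      then show ?thesis using Suc.IH Suc.prems(2,3) True by blast
    next
      case False
      have nb: "u \<in> nbrs E v" "v \<in> nbrs E u"
        using Suc.prems(3) G.nbrs_commute by (auto simp: G.arc_def)
      \<comment> \<open>The phase is now exactly \<open>p\<close>. One of its two rounds reaches the
        head \<open>u\<close>, the other all neighbours of \<open>u\<close>, among them every tail
        of the star.\<close>
      have x: "indist (Suc (Suc (?t p))) E E' x" using Suc.prems(1) by simp
      then have "indist (Suc (?t p)) E E' x" by (rule indist_mono[rotated]) simp
      then have u: "indist (Suc (?t p)) E E' u"
        using indist_nbr[OF x] nb(1) Suc.prems(2) by blast
      have near: "indist (?t p) E E' y" if "y = u \<or> y \<in> nbrs E u" for y
        using that u indist_mono[of "?t p" "Suc (?t p)" E E' u] indist_nbr[OF u] by auto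
      have data: "G.arc E v' u' = G.arc E' v' u' \<and>
          (G.arc E v' u' \<longrightarrow> G.phase E v' u' = G.phase E' v' u')"
        if "y = u \<or> y \<in> nbrs E u" "y = v' \<or> y = u'" for y v' u'
      proof (cases "u' \<in> nbrs E v'")
        case True
        have "indist (Suc (Suc L)) E E' y" using near[OF that(1)] by (rule indist_mono[rotated]) simp
        then show ?thesis using G.indist_arc_phase[OF _ that(2) True] by metis
      next
        case False
        have "nbrs E y = nbrs E' y" using near[OF that(1)] by (rule indist_nbrs)
        then have "u' \<notin> nbrs E' v'" using False that(2) G.nbrs_commute G'.nbrs_commute by metis
        then show ?thesis using False by (simp add: G.arc_def)
      qed
      \<comment> \<open>The star around \<open>u\<close> is treated as a whole, by induction on the
        tail ID, which is the greedy order within a phase.\<close>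
      have "G.arc_colour E (w, u) = G.arc_colour E' (w, u)"
        if "G.arc E w u" "G.phase E w u = p" for w
        using that
      proof (induction w rule: less_induct)
        case (less w)
        have wu: "w \<in> nbrs E u" using less.prems(1) G.nbrs_commute by (auto simp: G.arc_def)
        have wu': "G.arc E' w u" "G.phase E' w u = p"
          using data[of w w u] less.prems wu by auto
        have sub: "\<exists>y. (y = u \<or> y \<in> nbrs E u) \<and> (y = v' \<or> y = u')"
          if "{v', u'} \<inter> {w, u} \<noteq> {}" for v' u'
        proof -
          have "w = v' \<or> w = u' \<or> u = v' \<or> u = u'" using that by auto
          then show ?thesis using wu by metis
        qed
        show ?case unfolding G.arc_colour_def
        proof (rule greedy_cong)
          have "(v', u') \<in> G.conflicts E (w, u) \<and> G.key E (v', u') < G.key E (w, u) \<longleftrightarrow>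
              (v', u') \<in> G.conflicts E' (w, u) \<and> G.key E' (v', u') < G.key E' (w, u)" for v' u'
          proof (cases "{v', u'} \<inter> {w, u} \<noteq> {}")
            case True
            then obtain y where "y = u \<or> y \<in> nbrs E u" "y = v' \<or> y = u'" using sub by metis
            then have d: "G.arc E v' u' = G.arc E' v' u'"
              "G.arc E v' u' \<longrightarrow> G.phase E v' u' = G.phase E' v' u'"
              using data[of y v' u'] by metis+
            have mem: "(v', u') \<in> G.conflicts F (w, u) \<longleftrightarrow> G.arc F v' u'" for F
              using True by (simp add: G.conflicts_def)
            show ?thesis
            proof (cases "G.arc E v' u'")
              case True
              then have "G.arc E' v' u'" "G.phase E v' u' = G.phase E' v' u'" using d by simp_all
              then show ?thesis
                using True G.key_less_iff[OF less.prems(1) True] G'.key_less_iff[OF wu'(1)]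
                  less.prems(2) wu'(2) by (simp add: mem)
            qed (use d mem in simp)
          qed (simp add: G.conflicts_def)
          then show "{y \<in> G.conflicts E (w, u). G.key E y < G.key E (w, u)} =
              {y \<in> G.conflicts E' (w, u). G.key E' y < G.key E' (w, u)}" by auto
          fix y assume y: "y \<in> G.conflicts E (w, u)" "G.key E y < G.key E (w, u)"
          obtain v' u' where y': "y = (v', u')" "G.arc E v' u'" "{v', u'} \<inter> {w, u} \<noteq> {}"
            using y(1) by (auto simp: G.conflicts_def)
          then have k: "G.phase E v' u' < p \<or> G.phase E v' u' = p \<and> v' < w"
            using y(2) G.key_less_iff[OF less.prems(1)] less.prems(2) by simp
          \<comment> \<open>An arc of an earlier phase falls under the outer induction, applied at
            an endpoint \<open>z\<close> near \<open>u\<close>; one of the same phase belongs to the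
            same star and has a smaller tail.\<close>
          have "G.arc_colour E (v', u') = G.arc_colour E' (v', u')"
          proof (cases "G.phase E v' u' < p")
            case True
            obtain z where z: "z = u \<or> z \<in> nbrs E u" "z = v' \<or> z = u'" using sub[OF y'(3)] by metis
            show ?thesis by (rule Suc.IH[OF near[OF z(1)] z(2) y'(2) True])
          next
            case False
            then have "u' = u"
              using k G.same_phase_same_head[OF less.prems(1) y'(2,3)] less.prems(2) by simp
            then show ?thesis using less.IH[of v'] k False y'(2) by simp
          qed
          then show "greedy (G.key E) (G.conflicts E) y = greedy (G.key E') (G.conflicts E') y"
            using y'(1) by (simp add: G.arc_colour_def)
        qed
      qed
      then show ?thesis using Suc.prems(3,4) False by simp
    qed
  qed simp
qed

text \<open>There are at most \<open>(B + L) * A\<close> phases, so this radius covers the phase of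
  any edge.\<close>

lemma edge_colour_local:
  fixes A L B M :: nat
  assumes "layered_graph A L B M V E" "layered_graph A L B M V' E'"
    and ind: "indist (Suc (Suc L) + 2 * ((B + L) * A)) E E' v" and nb: "u \<in> nbrs E v"
  shows "colouring_params.edge_colour A L B M E v u = colouring_params.edge_colour A L B M E' v u"
proof -
  interpret G: layered_graph A L B M V E by fact
  interpret G': layered_graph A L B M V' E' by fact
  have "indist (Suc (Suc L)) E E' v" using ind by (rule indist_mono[rotated]) simp
  then have "G.arc E v u = G.arc E' v u" using G.indist_arc_phase nb by blast
  then have eq: "G.edge_arc E v u = G.edge_arc E' v u" by (simp add: G.edge_arc_def)
  show ?thesis
    using nb
  proof (cases rule: G.edge_arc_cases)
    case 1
    then show ?thesis
      using arc_colour_local[OF assms(1,2) ind _ 1(2) G.phase_less] eq by (simp add: G.edge_colour_def)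
  next
    case 2
    then show ?thesis
      using arc_colour_local[OF assms(1,2) ind _ 2(2) G.phase_less] eq by (simp add: G.edge_colour_def)
  qed
qed

section \<open>Rounds and colours\<close>

text \<open>When the round bound is zero nothing can be communicated, but an edge would force
  \<open>n \<ge> 2\<close> and positive arboricity.\<close>

lemma no_edges_of_degenerate_parameters:
  assumes "real a * ln (real n) = 0" "simple_graph V E" "card V = n" "arboricity E = a"
  shows "{u, v} \<notin> E"
proof
  assume e: "{u, v} \<in> E"
  then have uv: "u \<in> V" "v \<in> V" "u \<noteq> v"
    using simple_graph_nbrsD[OF assms(2), of u v] by (auto simp: nbrs_def)
  then have "card {u, v} \<le> n"
    using simple_graph_finite[OF assms(2)] assms(3) by (metis card_mono empty_subsetI insert_subset)
  then have "n \<ge> 2" using uv(3) by simp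
  then have "ln (real n) > 0" by simp
  moreover have "a > 0" using arboricity_pos[OF assms(2) e] assms(4) by simp
  ultimately show False using assms(1) by simp
qed

text \<open>IDs of logarithmically many bits are IDs below \<open>n ^ idexp\<close> for a constant
  \<open>idexp\<close>. The algorithm may depend on \<open>n\<close>, \<open>\<Delta>\<close> and
  \<open>a\<close>, which all vertices know, but not on the graph.\<close>

theorem mainTheorem12:
  "\<forall>idexp :: nat. \<exists>C1 :: nat. \<exists>C2 :: real. C2 > 0 \<and>
     (\<forall>(n :: nat) (\<Delta> :: nat) (a :: nat).
        \<exists>(init :: nat \<Rightarrow> nat set \<Rightarrow> nat) (step :: nat \<Rightarrow> (nat \<Rightarrow> nat option) \<Rightarrow> nat)
          (send :: nat \<Rightarrow> nat \<Rightarrow> nat) (out :: nat \<Rightarrow> nat \<Rightarrow> nat) (T :: nat).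
          real T \<le> C2 * real a * ln (real n) \<and>
          (\<forall>V E. simple_graph V E \<and> card V = n \<and> V \<subseteq> {..< n ^ idexp} \<and>
                 max_degree V E = \<Delta> \<and> arboricity E = a \<longrightarrow>
             proper_edge_colouring_output E (local_colour init step send out T E) \<and>
             card (colours_used E (local_colour init step send out T E)) \<le> \<Delta> + C1 * a))"
proof (intro allI)
  fix idexp :: nat
  \<comment> \<open>The \<open>L + 2\<close> rounds of preparation cost at most
    \<open>3 * a * L\<close> and the phases \<open>8 * (idexp + 1) * a * L\<close>; then
    \<open>L\<close> is at most \<open>2 / ln 2\<close> times \<open>ln n\<close>.\<close>
  define C2 where "C2 = (11 + 8 * real idexp) * (2 / ln 2)"
  have C2: "C2 > 0" unfolding C2_def by (intro mult_pos_pos) auto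
  have "\<exists>(init :: nat \<Rightarrow> nat set \<Rightarrow> nat) (step :: nat \<Rightarrow> (nat \<Rightarrow> nat option) \<Rightarrow> nat)
      (send :: nat \<Rightarrow> nat \<Rightarrow> nat) (out :: nat \<Rightarrow> nat \<Rightarrow> nat) (T :: nat).
      real T \<le> C2 * real a * ln (real n) \<and>
      (\<forall>V E. simple_graph V E \<and> card V = n \<and> V \<subseteq> {..< n ^ idexp} \<and>
             max_degree V E = \<Delta> \<and> arboricity E = a \<longrightarrow>
         proper_edge_colouring_output E (local_colour init step send out T E) \<and>
         card (colours_used E (local_colour init step send out T E)) \<le> \<Delta> + 5 * a)"
    for n \<Delta> a
  proof (cases "n \<ge> 2 \<and> a > 0")
    case False
    \<comment> \<open>For \<open>n = 0\<close> this rests on the default value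
      \<open>ln 0 = 0\<close>.\<close>
    then have zero: "real a * ln (real n) = 0" by (cases "n = 0") (auto simp: not_le less_2_cases_iff)
    then have "proper_edge_colouring_output E c \<and> card (colours_used E c) \<le> \<Delta> + 5 * a"
      if "simple_graph V E" "card V = n" "arboricity E = a" for V E c
      using no_edges_of_degenerate_parameters[OF zero that]
      by (simp add: proper_edge_colouring_output_def colours_used_def)
    then show ?thesis using zero by (intro exI[of _ 0] exI) (auto simp: mult.assoc)
  next
    case True
    \<comment> \<open>The added one makes \<open>n < 2 ^ L\<close> strict and \<open>L\<close>
      positive, as \<open>active_exhausted\<close> demands.\<close>
    define L where "L = Suc (nat \<lfloor>log 2 (real n)\<rfloor>)"
    define A where "A = 4 * a"
    define M where "M = n ^ idexp"
    define B where "B = idexp * L"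
    define T where "T = Suc (Suc L) + 2 * ((B + L) * A)"
    interpret colouring_params A L B M .
    have log1: "1 \<le> log 2 (real n)" using True by simp
    then have L: "log 2 (real n) < real L" "real L \<le> 2 * log 2 (real n)"
      unfolding L_def by linarith+
    have "real n = 2 powr log 2 (real n)" using True by simp
    also have "\<dots> < 2 powr real L" using L(1) by (intro powr_less_mono) auto
    also have "\<dots> = real (2 ^ L)" by (simp add: powr_realpow)
    finally have n2L: "n < 2 ^ L" unfolding of_nat_less_iff .
    have L0: "L > 0" by (simp add: L_def)
    have "M \<le> (2 ^ L) ^ idexp" unfolding M_def using n2L by (intro power_mono) auto
    then have M2B: "M \<le> 2 ^ B" by (simp add: B_def power_mult[symmetric] mult.commute)
    have "1 * 1 \<le> a * L" "1 * L \<le> a * L" using True L0 by (intro mult_le_mono; simp)+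
    then have "T \<le> 3 * (a * L) + 2 * ((B + L) * A)" unfolding T_def by linarith
    also have "\<dots> = (11 + 8 * idexp) * a * L" by (simp add: A_def B_def algebra_simps)
    finally have "real T \<le> real ((11 + 8 * idexp) * a * L)" unfolding of_nat_le_iff .
    also have "\<dots> = (11 + 8 * real idexp) * real a * real L" by simp
    also have "\<dots> \<le> (11 + 8 * real idexp) * real a * (2 * log 2 (real n))"
      using L(2) by (intro mult_left_mono) auto
    also have "\<dots> = C2 * real a * ln (real n)" by (simp add: C2_def log_def)
    finally have T: "real T \<le> C2 * real a * ln (real n)" .
    define valid where "valid V E \<longleftrightarrow> simple_graph V E \<and> card V = n \<and> V \<subseteq> {..< n ^ idexp} \<and>
      max_degree V E = \<Delta> \<and> arboricity E = a" for V E
    have layered: "layered_graph A L B M V E" if "valid V E" for V E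
    proof
      show "simple_graph V E" "V \<subseteq> {..<M}" "M \<le> 2 ^ B"
        using that M2B by (auto simp: valid_def M_def)
      show "\<not> active A E L v" for v
        using that True n2L L0 by (intro active_exhausted) (auto simp: valid_def A_def)
    qed
    \<comment> \<open>The vertex picks any admissible graph that explains what it has gathered and
      outputs the colours found there. By locality these agree with the colours in the true
      graph.\<close>
    define witness where "witness s = (SOME (E, v). (\<exists>V. valid V E) \<and> gather E T v = s)" for s
    define out where "out s u = (case witness s of (E, v) \<Rightarrow> edge_colour E v u)" for s u
    have out: "out (gather E T v) u = edge_colour E v u" if val: "valid V E" and nb: "u \<in> nbrs E v"
      for V E v u
    proof -
      obtain E' v' where w: "witness (gather E T v) = (E', v')" by fastforce
      have "case witness (gather E T v) of (E', v') \<Rightarrow>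
          (\<exists>V. valid V E') \<and> gather E' T v' = gather E T v"
        unfolding witness_def by (rule someI[of _ "(E, v)"]) (use val in auto)
      then obtain V' where V': "valid V' E'" "gather E' T v' = gather E T v" unfolding w by auto
      have fin: "finite (nbrs E x)" "finite (nbrs E' x)" for x
        using val V'(1) finite_nbrs unfolding valid_def by metis+
      have "v = v'" "indist T E E' v" using gather_eqD[OF fin V'(2)[symmetric]] by auto
      then show ?thesis
        using edge_colour_local[OF layered[OF val] layered[OF V'(1)], of v u] nb w
        unfolding T_def out_def by simp
    qed
    have "proper_edge_colouring_output E (local_colour gather_init gather_step (\<lambda>s u. s) out T E) \<and>
        card (colours_used E (local_colour gather_init gather_step (\<lambda>s u. s) out T E)) \<le> \<Delta> + 5 * a"
      if val: "valid V E" for V E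
    proof -
      let ?c = "local_colour gather_init gather_step (\<lambda>s u. s) out T E"
      interpret layered_graph A L B M V E using layered[OF val] .
      have c: "?c v u = edge_colour E v u" if "{v, u} \<in> E" for v u
        unfolding local_colour_def using out[OF val, of u v] that
        by (simp add: nbrs_def insert_commute)
      have nb: "{v, u} \<in> E \<longleftrightarrow> u \<in> nbrs E v" for v u by (simp add: nbrs_def insert_commute)
      have "?c u v = ?c v u" if "{u, v} \<in> E" for u v
        using that c[of u v] c[of v u] edge_arc_commute[of v u]
        by (simp add: nb nbrs_commute[of u v] edge_colour_def)
      moreover have "?c v u \<noteq> ?c v w" if "{v, u} \<in> E" "{v, w} \<in> E" "u \<noteq> w" for v u w
        using that c edge_colour_neq unfolding nb by simp
      ultimately have "proper_edge_colouring_output E ?c"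
        unfolding proper_edge_colouring_output_def by blast
      moreover have "colours_used E ?c \<subseteq> {..A + \<Delta>}"
      proof
        fix x assume "x \<in> colours_used E ?c"
        then obtain v u where "{v, u} \<in> E" "x = ?c v u" unfolding colours_used_def by blast
        then show "x \<in> {..A + \<Delta>}"
          using c edge_colour_le[of u v] nb val by (simp add: valid_def)
      qed
      then have "card (colours_used E ?c) \<le> card {..A + \<Delta>}" by (intro card_mono) auto
      \<comment> \<open>Colours from 0 to \<open>4 * a + \<Delta>\<close> are one more than that
        bound, and \<open>a \<ge> 1\<close> absorbs the extra one.\<close>
      then have "card (colours_used E ?c) \<le> \<Delta> + 5 * a" using True by (simp add: A_def)
      ultimately show ?thesis by blast
    qed
    then show ?thesis using T unfolding valid_def by blast
  qed
  then show "\<exists>C1 :: nat. \<exists>C2 :: real. C2 > 0 \<and>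
     (\<forall>(n :: nat) (\<Delta> :: nat) (a :: nat).
        \<exists>(init :: nat \<Rightarrow> nat set \<Rightarrow> nat) (step :: nat \<Rightarrow> (nat \<Rightarrow> nat option) \<Rightarrow> nat)
          (send :: nat \<Rightarrow> nat \<Rightarrow> nat) (out :: nat \<Rightarrow> nat \<Rightarrow> nat) (T :: nat).
          real T \<le> C2 * real a * ln (real n) \<and>
          (\<forall>V E. simple_graph V E \<and> card V = n \<and> V \<subseteq> {..< n ^ idexp} \<and>
                 max_degree V E = \<Delta> \<and> arboricity E = a \<longrightarrow>
             proper_edge_colouring_output E (local_colour init step send out T E) \<and>
             card (colours_used E (local_colour init step send out T E)) \<le> \<Delta> + C1 * a))"
    using C2 by (intro exI[of _ 5] exI[of _ C2]) blast
qed

end
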